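(* Let $\Omega=\mathbb{R}^d$. Suppose $f$ satisfies a uniform Kurdyka--\L ojasiewicz property on $\Omega_*$: it has the Kurdyka--\L ojasiewicz property at every $\bar{\mathbf{w}}\in\Omega_*$ with the same desingularizing function $\varphi$ and the same constant $\eta\in(0,\infty]$, with neighborhoods $U_{\bar{\mathbf{w}}}$. Fix $\mathbf{w}_0\in\mathbb{R}^d$, $\alpha>1$, $\epsilon_0>0$ with $f(\mathbf{w}_0)-f_*\le\epsilon_0$. Consider $\epsilon\in(0,\epsilon_0]$ with $\mathcal{L}_\epsilon\neq\emptyset$ and $$\mathcal{S}_\epsilon\setminus\Omega_*\subset\bigcup_{\bar{\mathbf{w}}\in\Omega_*}\left[U_{\bar{\mathbf{w}}}\cap\{\mathbf{w}:f(\bar{\mathbf{w}})<f(\mathbf{w})<f(\bar{\mathbf{w}})+\eta\}\right].$$ (1) RSG has an iteration complexity of $O\left(\alpha^2G^2\left(\frac{\varphi(\epsilon)}{\epsilon}\right)^2\lceil\log_\alpha(\frac{\epsilon_0}{\epsilon})\rceil\right)$ for obtaining a $2\epsilon$-optimal solution: there is $C>0$ independent of $\epsilon$ such that for every such $\epsilon$, RSG$(\mathbf{w}_0,K,t,\alpha)$ with $t=\lceil\alpha^2G^2(\varphi(\epsilon)/\epsilon)^2\rceil$ and $K=\lceil\log_\alpha(\epsilon_0/\epsilon)\rceil$ returns $\mathbf{w}_K$ with $f(\mathbf{w}_K)-f_*\le2\epsilon$ after at most $C\alpha^2G^2\left(\frac{\varphi(\epsilon)}{\epsilon}\right)^2\lceil\log_\alpha(\frac{\epsilon_0}{\epsilon})\rceil$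 iterations in total. (2) If in addition $\varphi(s)=cs^{1-\beta}$ for some $c>0$ and $\beta\in[0,1)$, then the iteration complexity of RSG for obtaining a $2\epsilon$-optimal solution is $O\left(\frac{\alpha^2G^2c^2(1-\beta)^2}{\epsilon^{2\beta}}\lceil\log_\alpha(\frac{\epsilon_0}{\epsilon})\rceil\right)$: there is $C>0$ independent of $\epsilon$ such that for every such $\epsilon$, RSG$(\mathbf{w}_0,K,t,\alpha)$ with $t=\left\lceil\frac{\alpha^2G^2c^2}{\epsilon^{2\beta}}\right\rceil$ and $K=\lceil\log_\alpha(\epsilon_0/\epsilon)\rceil$ returns $\mathbf{w}_K$ with $f(\mathbf{w}_K)-f_*\le2\epsilon$ after at most $C\,\frac{\alpha^2G^2c^2(1-\beta)^2}{\epsilon^{2\beta}}\lceil\log_\alpha(\frac{\epsilon_0}{\epsilon})\rceil$ iterations in total.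
   Context: Problem: $f$ is a lower semicontinuous convex function on $\mathbb{R}^d$, finite everywhere (unconstrained case, $\Omega=\mathbb{R}^d\subseteq\mathrm{dom}(f)$); $f_*:=\min_{\mathbf{w}}f(\mathbf{w})$ is attained, and $\Omega_*$ is the (nonempty) set of minimizers. Bounded subgradients: there is a constant $G>0$ such that $\|\mathbf{v}\|_2\le G$ for all $\mathbf{w}\in\mathbb{R}^d$ and all $\mathbf{v}\in\partial f(\mathbf{w})$. $\mathcal{L}_\epsilon:=\{\mathbf{w}:f(\mathbf{w})=f_*+\epsilon\}$, $\mathcal{S}_\epsilon:=\{\mathbf{w}:f(\mathbf{w})\le f_*+\epsilon\}$. Kurdyka--\L ojasiewicz property: $f$ has this property at $\bar{\mathbf{w}}$ if there exist $\eta\in(0,\infty]$, a neighborhood $U_{\bar{\mathbf{w}}}$ of $\bar{\mathbf{w}}$ and a continuous concave function $\varphi:[0,\eta)\to\mathbb{R}_+$ (the desingularizing function) such that (i) $\varphi(0)=0$; (ii) $\varphi$ is continuously differentiable on $(0,\eta)$; (iii) $\varphi'(s)>0$ for all $s\in(0,\eta)$; (iv) for all $\mathbf{w}\in U_{\bar{\mathbf{w}}}\cap\{\mathbf{w}:f(\bar{\mathbf{w}})<f(\mathbf{w})<f(\bar{\mathbf{w}})+\eta\}$, $\varphi'(f(\mathbf{w})-f(\bar{\mathbf{w}}))\,\|\partial f(\mathbf{w})\|_2\ge1$, where $\|\partial f(\mathbf{w})\|_2:=\min_{\mathbf{g}\in\partial f(\mathbf{w})}\|\mathbf{g}\|_2$.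 Algorithm RSG$(\mathbf{w}_0,K,t,\alpha)$ (given $\epsilon_0$ and $G$), in the case $\Omega=\mathbb{R}^d$: for $k=1,\dots,K$ let $\eta_k=\epsilon_0/(\alpha^kG^2)$; set $\mathbf{x}_1=\mathbf{w}_{k-1}$ and, for $\tau=1,\dots,t$, $\mathbf{x}_{\tau+1}=\mathbf{x}_\tau-\eta_k\mathbf{g}_\tau$, where $\mathbf{g}_\tau\in\partial f(\mathbf{x}_\tau)$ is an arbitrary subgradient returned by an oracle; set $\mathbf{w}_k=\frac1t\sum_{\tau=1}^t\mathbf{x}_\tau$. Output $\mathbf{w}_K$. Each $k$ is a stage; each $\tau$ within a stage is one iteration, so the total number of iterations is $tK$. *)

theory Defs
  imports "HOL-Analysis.Analysis"
begin

definition lower_semicontinuous :: "('a::topological_space \<Rightarrow> real) \<Rightarrow> bool" where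
  "lower_semicontinuous f \<longleftrightarrow> (\<forall>x. \<forall>a < f x. eventually (\<lambda>y. a < f y) (nhds x))"

definition subdifferential :: "('a::real_inner \<Rightarrow> real) \<Rightarrow> 'a \<Rightarrow> 'a set" where
  "subdifferential f w = {g. \<forall>u. f u \<ge> f w + g \<bullet> (u - w)}"

(* Meaningful only when the minimum is attained: f attains its minimum by hypothesis, and the
   subdifferential of a finite convex function on R^d is nonempty and closed. *)
definition min_over :: "('a \<Rightarrow> real) \<Rightarrow> 'a set \<Rightarrow> real" where
  "min_over h S = (LEAST r. r \<in> h ` S)"

definition min_value :: "('a \<Rightarrow> real) \<Rightarrow> real" where
  "min_value f = min_over f UNIV"

definition minimizers :: "('a \<Rightarrow> real) \<Rightarrow> 'a set" where
  "minimizers f = {w. \<forall>u. f w \<le> f u}"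

definition subdifferential_norm :: "('a::real_inner \<Rightarrow> real) \<Rightarrow> 'a \<Rightarrow> real" where
  "subdifferential_norm f w = min_over norm (subdifferential f w)"

definition level_set :: "('a \<Rightarrow> real) \<Rightarrow> real \<Rightarrow> 'a set" where
  "level_set f \<epsilon> = {w. f w = min_value f + \<epsilon>}"

definition sublevel_set :: "('a \<Rightarrow> real) \<Rightarrow> real \<Rightarrow> 'a set" where
  "sublevel_set f \<epsilon> = {w. f w \<le> min_value f + \<epsilon>}"

(* \<phi> is a total function whose values outside [0, \<eta>) are irrelevant; \<eta> may be infinite. *)
definition desingularizing :: "ereal \<Rightarrow> (real \<Rightarrow> real) \<Rightarrow> bool" where
  "desingularizing \<eta> \<phi> \<longleftrightarrow>
     (\<forall>s. 0 \<le> s \<and> ereal s < \<eta> \<longrightarrow> 0 \<le> \<phi> s) \<and>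
     continuous_on {s. 0 \<le> s \<and> ereal s < \<eta>} \<phi> \<and>
     concave_on {s. 0 \<le> s \<and> ereal s < \<eta>} \<phi> \<and>
     \<phi> 0 = 0 \<and>
     \<phi> C1_differentiable_on {s. 0 < s \<and> ereal s < \<eta>} \<and>
     (\<forall>s. 0 < s \<and> ereal s < \<eta> \<longrightarrow> deriv \<phi> s > 0)"

definition KL_slice :: "('a \<Rightarrow> real) \<Rightarrow> 'a \<Rightarrow> ereal \<Rightarrow> 'a set" where
  "KL_slice f wbar \<eta> = {w. f wbar < f w \<and> ereal (f w) < ereal (f wbar) + \<eta>}"

(* The Kurdyka-Lojasiewicz property of f at wbar, witnessed by the given \<eta>, U and \<phi>.
   The neighbourhood U need not be open. *)
definition KL_property_with ::
  "('a::real_inner \<Rightarrow> real) \<Rightarrow> 'a \<Rightarrow> ereal \<Rightarrow> 'a set \<Rightarrow> (real \<Rightarrow> real) \<Rightarrow> bool" where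
  "KL_property_with f wbar \<eta> U \<phi> \<longleftrightarrow>
     0 < \<eta> \<and> wbar \<in> interior U \<and> desingularizing \<eta> \<phi> \<and>
     (\<forall>w \<in> U \<inter> KL_slice f wbar \<eta>. deriv \<phi> (f w - f wbar) * subdifferential_norm f w \<ge> 1)"

(* v is a possible result of t subgradient steps of size h started at u, followed by averaging
   x 1, ..., x t; the oracle may answer with any subgradient, possibly a different one on each
   call at the same point. *)
definition RSG_stage ::
  "('a::real_inner \<Rightarrow> real) \<Rightarrow> real \<Rightarrow> nat \<Rightarrow> 'a \<Rightarrow> 'a \<Rightarrow> bool" where
  "RSG_stage f h t u v \<longleftrightarrow>
     (\<exists>x g. x 1 = u \<and>
        (\<forall>\<tau>\<in>{1..t}. g \<tau> \<in> subdifferential f (x \<tau>) \<and> x (Suc \<tau>) = x \<tau> - h *\<^sub>R g \<tau>) \<and>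
        v = (1 / real t) *\<^sub>R (\<Sum>\<tau>=1..t. x \<tau>))"

(* The set of all possible outputs. Every run performs t iterations in each of the K stages,
   hence t * K iterations in total. *)
definition RSG_outputs ::
  "('a::real_inner \<Rightarrow> real) \<Rightarrow> real \<Rightarrow> real \<Rightarrow> 'a \<Rightarrow> nat \<Rightarrow> nat \<Rightarrow> real \<Rightarrow> 'a set" where
  "RSG_outputs f G \<epsilon>\<^sub>0 w\<^sub>0 K t \<alpha> =
     {w K | w. w 0 = w\<^sub>0 \<and>
        (\<forall>k\<in>{1..K}. RSG_stage f (\<epsilon>\<^sub>0 / (\<alpha> ^ k * G\<^sup>2)) t (w (k - 1)) (w k))}"

definition RSG_iterations :: "nat \<Rightarrow> nat \<Rightarrow> nat" where
  "RSG_iterations K t = t * K"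

definition admissible_eps ::
  "('a \<Rightarrow> real) \<Rightarrow> ereal \<Rightarrow> ('a \<Rightarrow> 'a set) \<Rightarrow> real \<Rightarrow> real \<Rightarrow> bool" where
  "admissible_eps f \<eta> U \<epsilon>\<^sub>0 \<epsilon> \<longleftrightarrow>
     0 < \<epsilon> \<and> \<epsilon> \<le> \<epsilon>\<^sub>0 \<and> level_set f \<epsilon> \<noteq> {} \<and>
     sublevel_set f \<epsilon> - minimizers f \<subseteq> (\<Union>wbar\<in>minimizers f. U wbar \<inter> KL_slice f wbar \<eta>)"

end

theory Submission
  imports Defs
begin

text \<open>
  Write \<open>m\<close> for the minimum of \<open>f\<close> and \<open>M\<close> for the set of minimizers. Everything rests on an error
  bound: a point whose value is at most \<open>m + \<epsilon>\<close> lies within \<open>\<phi> \<epsilon>\<close> of \<open>M\<close>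
  (\<open>admissible_error_bound\<close>). The Kurdyka--Lojasiewicz inequality says that \<open>\<phi> (f - m)\<close> has slope at
  least \<open>1\<close> away from \<open>M\<close>, so it should decrease to \<open>0\<close> within a distance equal to its value.
  An argument by penalization makes this precise (\<open>error_bound\<close>): if \<open>\<phi> (f w - m)\<close> were smaller than
  the distance from \<open>w\<close> to \<open>M\<close>, then for some \<open>c < 1\<close> a minimizer of
  \<open>\<phi> (f x - m) + c * dist w x\<close> over a compact part of the sublevel set of \<open>w\<close> would stay away from
  \<open>M\<close>, as in Ekeland's principle. At that point \<open>f\<close> has a subgradient so short that the slope
  inequality fails.

  The error bound controls the distance to the sublevel set \<open>{f \<le> m + \<epsilon>}\<close> linearly: walking from \<open>w\<close>
  straight to its nearest minimizer, convexity tells when the value \<open>m + \<epsilon>\<close> has been reached, and the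
  remaining part of the segment has length at most \<open>\<phi> \<epsilon>\<close> (\<open>sublevel_point_near\<close>). The usual regret
  estimate for averaged subgradient steps, compared with that point of the sublevel set, then
  improves the bound for the excess \<open>f - m - \<epsilon>\<close> by the factor \<open>\<alpha>\<close> in each stage
  (\<open>RSG_stage_contracts\<close>), and after the stated number of stages this bound is at most \<open>\<epsilon>\<close>.

  For the iteration count the only issue is the rounding of the number \<open>t\<close> of steps per stage. Bounded
  subgradients make \<open>f\<close> Lipschitz, so a point of the level set has distance at least \<open>\<epsilon> / G\<close> from \<open>M\<close>,
  whence \<open>\<phi> \<epsilon> / \<epsilon> \<ge> 1 / G\<close> (\<open>admissible_ratio_ge\<close>). The quantity that is rounded up therefore exceeds
  \<open>1\<close>, and rounding costs at most a factor \<open>2\<close>. For \<open>\<phi> s = c * s powr (1 - \<beta>)\<close> the two step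
  counts coincide, and the constant \<open>2 / (1 - \<beta>)\<^sup>2\<close> absorbs the factor \<open>(1 - \<beta>)\<^sup>2\<close> in the claim.
\<close>

section \<open>Subgradients of finite convex functions\<close>

text \<open>
  Separating the strict epigraph of \<open>f\<close> from the hypograph of \<open>k\<close> gives an affine function between the
  two. The separating hyperplane cannot be vertical because \<open>f\<close> is finite everywhere. Taking for \<open>k\<close>
  a constant on a single point, or a downward cone, produces the two kinds of subgradients used below.
\<close>

lemma affine_sandwich:
  fixes f k :: "'a::euclidean_space \<Rightarrow> real"
  assumes cf: "convex_on UNIV f" and ck: "concave_on S k"
    and x0: "x0 \<in> S" "k x0 = f x0" and le: "\<And>x. x \<in> S \<Longrightarrow> k x \<le> f x"
  obtains g where "g \<in> subdifferential f x0"
    and "\<And>x. x \<in> S \<Longrightarrow> k x \<le> f x0 + g \<bullet> (x - x0)"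
proof -
  let ?A = "{(x, r). f x < r}" and ?B = "{(x, r). x \<in> S \<and> r \<le> k x}"
  have "convex ?A"
    unfolding convex_def
  proof clarsimp
    fix x y :: 'a and r s u v :: real
    assume *: "f x < r" "f y < s" "0 \<le> u" "0 \<le> v" "u + v = 1"
    have "f (u *\<^sub>R x + v *\<^sub>R y) \<le> u * f x + v * f y"
      using cf * unfolding convex_on_def by auto
    moreover have "u * f x + v * f y < u * r + v * s"
    proof (cases "u = 0")
      case True
      then show ?thesis using * by simp
    next
      case False
      then have "u * f x < u * r" using * by simp
      moreover have "v * f y \<le> v * s" using * by (simp add: mult_left_mono)
      ultimately show ?thesis by linarith
    qed
    ultimately show "f (u *\<^sub>R x + v *\<^sub>R y) < u * r + v * s" by linarith
  qed
  moreover have "convex ?B"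
    unfolding convex_def
  proof clarsimp
    fix x y :: 'a and r s u v :: real
    assume *: "x \<in> S" "r \<le> k x" "y \<in> S" "s \<le> k y" "0 \<le> u" "0 \<le> v" "u + v = 1"
    have c: "convex_on S (\<lambda>x. - k x)" using ck by (simp add: concave_on_def)
    have "u *\<^sub>R x + v *\<^sub>R y \<in> S"
      using c * unfolding convex_on_def convex_def by blast
    moreover have "- k (u *\<^sub>R x + v *\<^sub>R y) \<le> u * (- k x) + v * (- k y)"
      using c * unfolding convex_on_def by blast
    moreover have "u * r \<le> u * k x" "v * s \<le> v * k y"
      using * by (simp_all add: mult_left_mono)
    ultimately show "u *\<^sub>R x + v *\<^sub>R y \<in> S \<and> u * r + v * s \<le> k (u *\<^sub>R x + v *\<^sub>R y)"
      by simp
  qed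
  moreover have "(x0, f x0 + 1) \<in> ?A" "(x0, k x0) \<in> ?B" using x0 by auto
  moreover have "?B \<inter> ?A = {}" using le by fastforce
  ultimately obtain d \<gamma> where d: "d \<noteq> 0" "\<forall>p\<in>?B. d \<bullet> p \<le> \<gamma>" "\<forall>p\<in>?A. d \<bullet> p \<ge> \<gamma>"
    using separating_hyperplane_sets[of ?B ?A] by blast
  obtain a b where ab: "d = (a, b)" by (cases d)
  have B: "a \<bullet> x + b * r \<le> \<gamma>" if "x \<in> S" "r \<le> k x" for x r
    using d(2) that ab by (auto simp: inner_prod_def)
  have A: "a \<bullet> x + b * r \<ge> \<gamma>" if "f x < r" for x r
    using d(3) that ab by (auto simp: inner_prod_def)
  have A': "a \<bullet> x + b * f x \<ge> \<gamma>" for x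
  proof (rule field_le_epsilon)
    fix e :: real assume "e > 0"
    define \<delta> where "\<delta> = e / (\<bar>b\<bar> + 1)"
    have "\<delta> > 0" using \<open>e > 0\<close> by (simp add: \<delta>_def)
    have "b * \<delta> \<le> \<bar>b\<bar> * \<delta>" using \<open>\<delta> > 0\<close> by (simp add: mult_right_mono)
    also have "\<dots> \<le> e" using \<open>e > 0\<close> by (simp add: \<delta>_def field_simps)
    finally show "\<gamma> \<le> a \<bullet> x + b * f x + e"
      using A[of x "f x + \<delta>"] \<open>\<delta> > 0\<close> by (simp add: algebra_simps)
  qed
  have at0: "a \<bullet> x0 + b * f x0 = \<gamma>"
    using A'[of x0] B[of x0 "k x0"] x0 by simp
  have "b \<ge> 0"
    using A[of x0 "f x0 + 1"] at0 by (simp add: algebra_simps)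
  \<comment> \<open>If the hyperplane were vertical, moving from \<open>x0\<close> in the direction \<open>- a\<close> would cross it.\<close>
  have "b \<noteq> 0"
  proof
    assume "b = 0"
    then have "a \<bullet> a \<le> 0" using A'[of "x0 - a"] at0 by (simp add: inner_diff_right)
    then have "a = 0" by (metis inner_gt_zero_iff not_le)
    then show False using d(1) ab \<open>b = 0\<close> by (simp add: zero_prod_def)
  qed
  with \<open>b \<ge> 0\<close> have b: "b > 0" by simp
  define g where "g = - (a /\<^sub>R b)"
  have g: "b * (g \<bullet> (x - x0)) = a \<bullet> x0 - a \<bullet> x" for x
    using b by (simp add: g_def inner_diff_right field_simps)
  show thesis
  proof
    show "g \<in> subdifferential f x0"
      unfolding subdifferential_def
    proof clarify
      fix x
      have "b * (f x0 + g \<bullet> (x - x0)) \<le> b * f x"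
        using A'[of x] at0 g[of x] by (simp add: distrib_left)
      then show "f x0 + g \<bullet> (x - x0) \<le> f x" using b by simp
    qed
    fix x assume "x \<in> S"
    then have "b * k x \<le> b * (f x0 + g \<bullet> (x - x0))"
      using B[of x "k x"] at0 g[of x] by (simp add: distrib_left)
    then show "k x \<le> f x0 + g \<bullet> (x - x0)" using b by simp
  qed
qed

lemma subdifferential_nonempty:
  fixes f :: "'a::euclidean_space \<Rightarrow> real"
  assumes "convex_on UNIV f"
  obtains g where "g \<in> subdifferential f w"
proof -
  have "concave_on {w} (\<lambda>_. f w)" by (simp add: concave_on_def convex_on_const)
  from affine_sandwich[OF assms this] show thesis using that by auto
qed

text \<open>
  The directional derivatives of \<open>f\<close> at \<open>w\<close> are at least \<open>- L\<close>, and the steepest descent rate is the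
  smallest norm of a subgradient. The sandwich with the cone \<open>f w - L * dist w x\<close> exhibits such a
  subgradient.
\<close>

lemma lipschitz_below_imp_small_subgradient:
  fixes f :: "'a::euclidean_space \<Rightarrow> real"
  assumes "convex_on UNIV f" "L \<ge> 0" and low: "\<And>x. f w - L * dist w x \<le> f x"
  obtains g where "g \<in> subdifferential f w" "norm g \<le> L"
proof -
  have "convex_on UNIV (\<lambda>x. L * dist w x + (- f w))"
    using assms(2) by (intro convex_on_add convex_on_cmul convex_on_dist) (simp_all add: convex_on_const)
  then have "concave_on UNIV (\<lambda>x. f w - L * dist w x)"
    by (simp add: concave_on_def)
  then obtain g where g: "g \<in> subdifferential f w" "\<And>x. f w - L * dist w x \<le> f w + g \<bullet> (x - w)"
    using affine_sandwich[OF assms(1), of UNIV "\<lambda>x. f w - L * dist w x" w] low by auto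
  \<comment> \<open>The cone lies below the affine function; compare the two in the steepest descent direction.\<close>
  have "norm g * norm g \<le> L * norm g"
    using g(2)[of "w - g"] by (simp add: dist_norm dot_square_norm power2_eq_square)
  then have "norm g \<le> L" using \<open>L \<ge> 0\<close> by (cases "g = 0") auto
  with g(1) show thesis using that by blast
qed

text \<open>
  The norm of the subdifferential is defined as a least element of a set of reals, so it means something
  only once the minimum is attained. It is, because the subdifferential is closed.
\<close>

lemma subdifferential_norm_le:
  fixes f :: "'a::euclidean_space \<Rightarrow> real"
  assumes "g \<in> subdifferential f w"
  shows "subdifferential_norm f w \<le> norm g"
proof -
  have "subdifferential f w = (\<Inter>u. {g. g \<bullet> (u - w) \<le> f u - f w})"
    by (auto simp: subdifferential_def algebra_simps)
  then have "closed (subdifferential f w)"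
    by (auto intro!: closed_INT closed_Collect_le continuous_intros)
  then obtain g' where g': "g' \<in> subdifferential f w"
      "\<And>y. y \<in> subdifferential f w \<Longrightarrow> dist 0 g' \<le> dist 0 y"
    using distance_attains_inf[of "subdifferential f w" 0] assms by blast
  then have "subdifferential_norm f w = norm g'"
    unfolding subdifferential_norm_def min_over_def by (intro Least_equality) auto
  then show ?thesis using g'(2)[OF assms] by simp
qed

lemma bounded_subgradients_imp_lipschitz:
  fixes f :: "'a::euclidean_space \<Rightarrow> real"
  assumes "convex_on UNIV f" and G: "\<forall>w. \<forall>v\<in>subdifferential f w. norm v \<le> G"
  shows "f w - f u \<le> G * dist w u"
proof -
  obtain g where g: "g \<in> subdifferential f w" using subdifferential_nonempty[OF assms(1)] .
  have "f w - f u \<le> g \<bullet> (w - u)"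
    using g by (auto simp: subdifferential_def inner_diff_right dest: spec[of _ u])
  also have "\<dots> \<le> norm g * norm (w - u)" by (rule norm_cauchy_schwarz)
  also have "\<dots> \<le> G * dist w u" using G g by (auto simp: dist_norm intro: mult_right_mono)
  finally show ?thesis .
qed

lemma min_value_eq: "p \<in> minimizers f \<Longrightarrow> min_value f = f p"
  unfolding min_value_def min_over_def minimizers_def by (intro Least_equality) auto

lemma closed_minimizers:
  fixes f :: "'a::euclidean_space \<Rightarrow> real"
  assumes "convex_on UNIV f"
  shows "closed (minimizers f)"
proof -
  have "continuous_on UNIV f" using convex_on_continuous[OF open_UNIV assms] .
  moreover have "minimizers f = (\<Inter>u. {w. f w \<le> f u})" by (auto simp: minimizers_def)
  ultimately show ?thesis by (auto intro!: closed_INT closed_Collect_le continuous_intros)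
qed

section \<open>Desingularizing functions\<close>

lemma ereal_diff_less_iff: "ereal (x - y) < \<eta> \<longleftrightarrow> ereal x < ereal y + \<eta>"
  by (cases \<eta>) auto

lemma desingularizing_le_tangent:
  assumes "desingularizing \<eta> \<phi>" "0 < s" "ereal s < \<eta>" "0 \<le> r" "ereal r < \<eta>"
  shows "\<phi> r \<le> \<phi> s + deriv \<phi> s * (r - s)"
proof -
  let ?I = "{s. 0 \<le> s \<and> ereal s < \<eta>}" and ?J = "{s. 0 < s \<and> ereal s < \<eta>}"
  have cv: "convex_on ?I (\<lambda>x. - \<phi> x)" and c1: "\<phi> C1_differentiable_on ?J"
    using assms(1) by (auto simp: desingularizing_def concave_on_def)
  have "open ?J"
    by (intro open_Collect_conj open_Collect_less continuous_on_ereal continuous_intros)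
  then have int: "s \<in> interior ?I"
    using assms(2,3) by (intro interiorI[of ?J]) auto
  have "\<phi> differentiable at s" using c1 assms(2,3) by (auto simp: C1_differentiable_on_eq)
  then have "(\<phi> has_real_derivative deriv \<phi> s) (at s)"
    using DERIV_deriv_iff_real_differentiable by blast
  then have "((\<lambda>x. - \<phi> x) has_real_derivative - deriv \<phi> s) (at s within ?I)"
    by (rule DERIV_minus[OF has_field_derivative_at_within])
  moreover have "connected ?I" using cv by (simp add: convex_on_imp_convex convex_connected)
  ultimately have "- \<phi> r - - \<phi> s \<ge> - deriv \<phi> s * (r - s)"
    using assms(4,5) by (intro convex_on_imp_above_tangent[OF cv _ int]) simp_all
  then show ?thesis by simp
qed

text \<open>
  Comparing with the tangent at the larger point gives monotonicity including the end point \<open>0\<close>, where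
  nothing is known about the derivative.
\<close>

lemma desingularizing_mono:
  assumes "desingularizing \<eta> \<phi>" "0 \<le> r" "r \<le> s" "ereal s < \<eta>"
  shows "\<phi> r \<le> \<phi> s"
proof (cases "r = s")
  case False
  then have s: "0 < s" using assms by simp
  have r: "ereal r < \<eta>" using assms by (meson ereal_less_eq(3) le_less_trans)
  have "0 < deriv \<phi> s" using assms(1,4) s by (simp add: desingularizing_def)
  then have "deriv \<phi> s * (r - s) \<le> 0" using assms(3) by (simp add: mult_nonneg_nonpos)
  then show ?thesis using desingularizing_le_tangent[OF assms(1) s assms(4,2) r] by simp
qed simp

section \<open>From the slope inequality to an error bound\<close>

text \<open>
  If \<open>\<phi> (f w - min_value f)\<close> is less than the distance \<open>d\<close> from \<open>w\<close> to the minimizers, pick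
  \<open>c < 1\<close> that is still larger than their quotient and minimize \<open>\<phi> (f x - min_value f) + c * dist w x\<close>
  over the part of the sublevel set of \<open>w\<close> in the ball of radius \<open>d\<close>. The penalty keeps the minimum
  point \<open>v\<close> strictly inside the ball, hence off the minimizers. Minimality bounds the descent rate of
  \<open>\<phi> (f x - min_value f)\<close> at \<open>v\<close> by \<open>c\<close>; dividing by the derivative of \<open>\<phi>\<close> bounds that of \<open>f\<close>, and a
  subgradient of that norm violates the slope inequality since \<open>c < 1\<close>.
\<close>

lemma error_bound:
  fixes f :: "'a::euclidean_space \<Rightarrow> real"
  assumes cf: "convex_on UNIV f" and ne: "minimizers f \<noteq> {}" and \<phi>: "desingularizing \<eta> \<phi>"
    and fin: "ereal (f w - min_value f) < \<eta>"
    and slope: "\<And>x g. \<lbrakk>f x \<le> f w; x \<notin> minimizers f; g \<in> subdifferential f x\<rbrakk>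
        \<Longrightarrow> 1 \<le> deriv \<phi> (f x - min_value f) * norm g"
  shows "infdist w (minimizers f) \<le> \<phi> (f w - min_value f)"
proof (rule ccontr)
  define m where "m = min_value f"
  define d where "d = infdist w (minimizers f)"
  assume "\<not> ?thesis"
  then have less: "\<phi> (f w - m) < d" by (simp add: d_def m_def)
  obtain p where p: "p \<in> minimizers f" using ne by auto
  have m: "m = f p" using min_value_eq[OF p] by (simp add: m_def)
  have mle: "m \<le> f x" for x using p by (auto simp: m minimizers_def)
  have range: "0 \<le> f x - m \<and> ereal (f x - m) < \<eta>" if "f x \<le> f w" for x
  proof -
    have "ereal (f x - m) \<le> ereal (f w - m)" using that by simp
    then show ?thesis using fin mle[of x] unfolding m_def by (meson diff_ge_0_iff_ge le_less_trans)
  qed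
  have pos: "0 \<le> \<phi> (f x - m)" if "f x \<le> f w" for x
    using \<phi> range[OF that] by (simp add: desingularizing_def)
  have dpos: "0 < d" using pos[of w] less by simp
  have "\<phi> (f w - m) / d < 1" "0 \<le> \<phi> (f w - m) / d" using less dpos pos[of w] by simp_all
  then obtain c where c: "0 < c" "c < 1" "\<phi> (f w - m) / d < c"
    by (meson dense le_less_trans)
  then have cd: "\<phi> (f w - m) < c * d" using dpos by (simp add: field_simps)
  have contf: "continuous_on UNIV f" using convex_on_continuous[OF open_UNIV cf] .
  define S where "S = {x. f x \<le> f w} \<inter> cball w d"
  define F where "F = (\<lambda>x. \<phi> (f x - m) + c * dist w x)"
  have "closed {x. f x \<le> f w}"
    using contf by (intro closed_Collect_le continuous_intros)
  then have "compact S" unfolding S_def by (intro closed_Int_compact) auto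
  moreover have "w \<in> S" using dpos by (simp add: S_def)
  moreover have "continuous_on S F"
  proof -
    have "continuous_on {s. 0 \<le> s \<and> ereal s < \<eta>} \<phi>" using \<phi> by (simp add: desingularizing_def)
    moreover have "continuous_on S (\<lambda>x. f x - m)"
      using contf by (intro continuous_intros) (auto intro: continuous_on_subset)
    ultimately have "continuous_on S (\<lambda>x. \<phi> (f x - m))"
      by (rule continuous_on_compose2) (use range in \<open>auto simp: S_def\<close>)
    then show ?thesis unfolding F_def by (intro continuous_intros)
  qed
  ultimately obtain v where v: "v \<in> S" and vmin: "\<And>x. x \<in> S \<Longrightarrow> F v \<le> F x"
    using continuous_attains_inf[of S F] by blast
  have fv: "f v \<le> f w" using v by (simp add: S_def)
  have "c * dist w v \<le> \<phi> (f w - m)"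
    using vmin[OF \<open>w \<in> S\<close>] pos[OF fv] by (simp add: F_def)
  then have "c * dist w v < c * d" using cd by simp
  then have near: "dist w v < d" using c by simp
  then have vM: "v \<notin> minimizers f" using infdist_le[of v "minimizers f" w] by (auto simp: d_def)
  then have s: "0 < f v - m"
    using mle unfolding minimizers_def by (smt (verit) mem_Collect_eq)
  define q where "q = deriv \<phi> (f v - m)"
  have q: "0 < q" using \<phi> s range[OF fv] by (simp add: q_def desingularizing_def)
  define L where "L = c / q"
  have loc: "f v \<le> f x + L * dist v x" if x: "x \<in> ball v (d - dist w v)" for x
  proof (cases "f x \<le> f v")
    \<comment> \<open>Only here does minimality apply: larger values of \<open>f\<close> may leave the sublevel set.\<close>
    case True
    have "dist w x \<le> dist w v + dist v x" by (rule dist_triangle)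
    then have "x \<in> S" using True fv x by (auto simp: S_def)
    then have "\<phi> (f v - m) + c * dist w v \<le> \<phi> (f x - m) + c * dist w x"
      using vmin by (simp add: F_def)
    moreover have "c * dist w x \<le> c * dist w v + c * dist v x"
      using c \<open>dist w x \<le> _\<close> by (simp flip: distrib_left)
    \<comment> \<open>Concavity of \<open>\<phi>\<close> turns a decrease of \<open>f\<close> into a decrease of \<open>\<phi> (f x - m)\<close> at rate at least \<open>q\<close>.\<close>
    moreover have "\<phi> (f x - m) \<le> \<phi> (f v - m) + q * ((f x - m) - (f v - m))"
      unfolding q_def using range[OF fv] range[of x] True fv s
      by (intro desingularizing_le_tangent[OF \<phi>]) auto
    ultimately have "q * (f v - f x) \<le> c * dist v x" by (simp add: algebra_simps)
    then show ?thesis using q by (simp add: L_def field_simps)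
  next
    case False
    then show ?thesis using c q by (smt (verit) L_def divide_pos_pos mult_nonneg_nonneg zero_le_dist)
  qed
  have "L > 0" using c q by (simp add: L_def)
  \<comment> \<open>A local minimum of a convex function is global, which removes the restriction to the ball.\<close>
  have "convex_on UNIV (\<lambda>x. f x + L * dist v x)"
    using \<open>L > 0\<close> cf by (intro convex_on_add convex_on_cmul convex_on_dist) auto
  then have "\<forall>x\<in>UNIV. f v + L * dist v v \<le> f x + L * dist v x"
    using near loc by (intro convex_local_global_minimum[of "d - dist w v" UNIV]) auto
  then have "f v - L * dist v x \<le> f x" for x by (simp add: algebra_simps)
  then obtain g where g: "g \<in> subdifferential f v" "norm g \<le> L"
    using lipschitz_below_imp_small_subgradient[OF cf, of L v] \<open>L > 0\<close> by auto
  have "1 \<le> q * norm g" using slope[OF fv vM g(1)] by (simp add: q_def m_def)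
  also have "\<dots> \<le> q * L" using g q by simp
  also have "\<dots> = c" using q by (simp add: L_def)
  finally show False using c by simp
qed

text \<open>
  On the segment from the nearest minimizer \<open>p\<close> to \<open>w\<close>, take the point \<open>z\<close> at which the chord of \<open>f\<close> has
  height \<open>min_value f + \<epsilon>\<close>. Since \<open>p\<close> is a nearest minimizer to \<open>z\<close> as well, the part from \<open>z\<close> to
  \<open>p\<close> has length at most \<open>R\<close>, and the part from \<open>w\<close> to \<open>z\<close> relates to it by the factor
  \<open>(f w - min_value f - \<epsilon>) / \<epsilon>\<close>.
\<close>

lemma sublevel_point_near:
  fixes f :: "'a::euclidean_space \<Rightarrow> real"
  assumes cf: "convex_on UNIV f" and ne: "minimizers f \<noteq> {}" and \<epsilon>: "0 < \<epsilon>"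
    and bound: "\<And>z. f z \<le> min_value f + \<epsilon> \<Longrightarrow> infdist z (minimizers f) \<le> R"
    and w: "min_value f + \<epsilon> < f w"
  obtains z where "f z \<le> min_value f + \<epsilon>" "\<epsilon> * dist w z \<le> R * (f w - min_value f - \<epsilon>)"
proof -
  define m where "m = min_value f"
  define D where "D = f w - m"
  have D: "\<epsilon> < D" using w by (simp add: D_def m_def)
  obtain p where p: "p \<in> minimizers f" "infdist w (minimizers f) = dist w p"
    using infdist_attains_inf[OF closed_minimizers[OF cf] ne] .
  define l where "l = \<epsilon> / D"
  have l: "0 < l" "l < 1" "l * D = \<epsilon>" using D \<epsilon> by (auto simp: l_def)
  define z where "z = (1 - l) *\<^sub>R p + l *\<^sub>R w"
  have "f z \<le> (1 - l) * f p + l * f w"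
    using cf l unfolding z_def convex_on_def by auto
  also have "\<dots> = m + l * D" using min_value_eq[OF p(1)] by (simp add: m_def D_def algebra_simps)
  finally have fz: "f z \<le> m + \<epsilon>" using l by simp
  have "w - z = (1 - l) *\<^sub>R (w - p)" by (simp add: z_def algebra_simps)
  then have wz: "dist w z = (1 - l) * dist w p" using l by (simp add: dist_norm)
  \<comment> \<open>Distances to the minimizers drop at unit speed on the way from \<open>w\<close> to \<open>p\<close>.\<close>
  have "dist w p \<le> infdist z (minimizers f) + dist w z"
    using infdist_triangle[of w "minimizers f" z] p(2) by simp
  also have "\<dots> \<le> R + (1 - l) * dist w p" using bound[of z] fz wz by (simp add: m_def)
  finally have "l * dist w p \<le> R" by (simp add: algebra_simps)
  then have "(l * dist w p) * (D - \<epsilon>) \<le> R * (D - \<epsilon>)" using D by (simp add: mult_right_mono)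
  moreover have "\<epsilon> * dist w z = (l * dist w p) * (D - \<epsilon>)"
    unfolding wz l(3)[symmetric] by (simp add: algebra_simps)
  ultimately show thesis using that[of z] fz by (simp add: D_def m_def)
qed

section \<open>One stage of the restarted subgradient method\<close>

text \<open>
  A subgradient step changes the squared distance to \<open>z\<close> by at most \<open>- 2 * h * (f (x \<tau>) - f z)\<close> plus
  \<open>(h * G)\<^sup>2\<close>. These changes telescope, and Jensen's inequality passes to the averaged point.
\<close>

lemma RSG_stage_regret:
  fixes f :: "'a::euclidean_space \<Rightarrow> real"
  assumes cf: "convex_on UNIV f" and G: "\<forall>w. \<forall>v\<in>subdifferential f w. norm v \<le> G"
    and h: "0 < h" and t: "0 < t" and stage: "RSG_stage f h t u v"
  shows "f v - f z \<le> h * G\<^sup>2 / 2 + (dist u z)\<^sup>2 / (2 * h * real t)"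
proof -
  obtain x g where x1: "x 1 = u"
    and step: "\<And>\<tau>. \<tau> \<in> {1..t} \<Longrightarrow> g \<tau> \<in> subdifferential f (x \<tau>) \<and> x (Suc \<tau>) = x \<tau> - h *\<^sub>R g \<tau>"
    and v: "v = (1 / real t) *\<^sub>R (\<Sum>\<tau>=1..t. x \<tau>)"
    using stage unfolding RSG_stage_def by blast
  have expand: "(norm (a - h *\<^sub>R b))\<^sup>2 = (norm a)\<^sup>2 - 2 * h * (b \<bullet> a) + (h * norm b)\<^sup>2" for a b :: 'a
    by (simp add: power_mult_distrib power2_norm_eq_inner inner_diff_left inner_diff_right inner_commute)
      (simp add: power2_eq_square algebra_simps)
  have "2 * h * (\<Sum>\<tau>=1..n. f (x \<tau>) - f z) + (dist (x (Suc n)) z)\<^sup>2 \<le> (dist u z)\<^sup>2 + real n * (h * G)\<^sup>2"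
    if "n \<le> t" for n
    using that
  proof (induction n)
    case 0
    then show ?case using x1 by simp
  next
    case (Suc n)
    let ?y = "x (Suc n)" and ?g = "g (Suc n)"
    have st: "?g \<in> subdifferential f ?y" "x (Suc (Suc n)) = ?y - h *\<^sub>R ?g"
      using step[of "Suc n"] Suc.prems by auto
    have "norm ?g \<le> G" using G st by blast
    then have "(h * norm ?g)\<^sup>2 \<le> (h * G)\<^sup>2" using h by (intro power_mono) auto
    moreover have "f ?y - f z \<le> ?g \<bullet> (?y - z)"
      using st(1) by (auto simp: subdifferential_def inner_diff_right dest: spec[of _ z])
    then have "2 * h * (f ?y - f z) \<le> 2 * h * (?g \<bullet> (?y - z))" using h by simp
    moreover have "x (Suc (Suc n)) - z = (?y - z) - h *\<^sub>R ?g" using st(2) by simp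
    then have "(dist (x (Suc (Suc n))) z)\<^sup>2
        = (dist ?y z)\<^sup>2 - 2 * h * (?g \<bullet> (?y - z)) + (h * norm ?g)\<^sup>2"
      using expand[of "?y - z" ?g] by (simp only: dist_norm)
    ultimately show ?case using Suc by (simp add: algebra_simps)
  qed
  from this[of t] have sum: "2 * h * (\<Sum>\<tau>=1..t. f (x \<tau>) - f z) \<le> (dist u z)\<^sup>2 + real t * (h * G)\<^sup>2"
    by (smt (verit) order_refl zero_le_power2)
  have "f v \<le> (\<Sum>\<tau>=1..t. 1 / real t * f (x \<tau>))"
    unfolding v scaleR_sum_right using t by (intro convex_on_sum[OF _ _ cf]) auto
  then have "real t * (f v - f z) \<le> (\<Sum>\<tau>=1..t. f (x \<tau>) - f z)"
    using t by (simp add: sum_subtractf field_simps flip: sum_distrib_left sum_divide_distrib)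
  then have "2 * h * (real t * (f v - f z)) \<le> 2 * h * (\<Sum>\<tau>=1..t. f (x \<tau>) - f z)"
    using h by simp
  also note sum
  finally show ?thesis using h t by (simp add: field_simps power2_eq_square)
qed

text \<open>
  With step size \<open>e / G\<^sup>2\<close> the first term of the regret is \<open>e / 2\<close>, and \<open>t\<close> is chosen so large that
  the second one is at most \<open>e / 2\<close> too. The comparison point \<open>z\<close> contributes the remaining \<open>\<epsilon>\<close>.
\<close>

lemma RSG_stage_contracts:
  fixes f :: "'a::euclidean_space \<Rightarrow> real"
  assumes cf: "convex_on UNIV f" and G: "\<forall>w. \<forall>v\<in>subdifferential f w. norm v \<le> G" "0 < G"
    and e: "0 < e" and \<epsilon>: "0 < \<epsilon>"
    and t: "0 < t" "\<alpha>\<^sup>2 * G\<^sup>2 * (R / \<epsilon>)\<^sup>2 \<le> real t"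
    and stage: "RSG_stage f (e / G\<^sup>2) t u v"
    and z: "f z \<le> m + \<epsilon>" "\<epsilon> * dist u z \<le> R * (\<alpha> * e)"
  shows "f v - m \<le> e + \<epsilon>"
proof -
  let ?h = "e / G\<^sup>2"
  have h: "0 < ?h" using e G by simp
  have "?h * G\<^sup>2 = e" using G by simp
  then have "f v - f z \<le> e / 2 + (dist u z)\<^sup>2 / (2 * ?h * real t)"
    using RSG_stage_regret[OF cf G(1) h t(1) stage, of z] by (simp only:)
  moreover have "(dist u z)\<^sup>2 / (2 * ?h * real t) \<le> e / 2"
  proof -
    have "dist u z \<le> (R / \<epsilon>) * (\<alpha> * e)" using z(2) \<epsilon> by (simp add: field_simps)
    then have "(dist u z)\<^sup>2 \<le> ((R / \<epsilon>) * (\<alpha> * e))\<^sup>2" by (intro power_mono) auto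
    then have "G\<^sup>2 * (dist u z)\<^sup>2 \<le> G\<^sup>2 * ((R / \<epsilon>) * (\<alpha> * e))\<^sup>2" by (simp add: mult_left_mono)
    also have "\<dots> = (\<alpha>\<^sup>2 * G\<^sup>2 * (R / \<epsilon>)\<^sup>2) * e\<^sup>2" by (simp add: power_mult_distrib power_divide)
    also have "\<dots> \<le> real t * e\<^sup>2" using t by (simp add: mult_right_mono)
    finally have "G\<^sup>2 * (dist u z)\<^sup>2 \<le> real t * e\<^sup>2" .
    then show ?thesis using e t G by (simp add: field_simps power2_eq_square)
  qed
  ultimately show ?thesis using z(1) by linarith
qed

section \<open>All stages together\<close>

text \<open>
  Each stage is compared with a point of the sublevel set close to where the stage starts, or with the
  starting point itself if that lies in the sublevel set already. So the bound for the excess over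
  \<open>min_value f + \<epsilon>\<close> shrinks by the factor \<open>\<alpha>\<close> from stage to stage.
\<close>

lemma RSG_output_accuracy:
  fixes f :: "'a::euclidean_space \<Rightarrow> real"
  assumes cf: "convex_on UNIV f" and ne: "minimizers f \<noteq> {}"
    and G: "\<forall>w. \<forall>v\<in>subdifferential f w. norm v \<le> G" "0 < G"
    and \<alpha>: "0 < \<alpha>" and \<epsilon>0: "0 < \<epsilon>0" "f w0 - min_value f \<le> \<epsilon>0"
    and \<epsilon>: "0 < \<epsilon>" and R: "0 \<le> R"
    and bound: "\<And>z. f z \<le> min_value f + \<epsilon> \<Longrightarrow> infdist z (minimizers f) \<le> R"
    and t: "0 < t" "\<alpha>\<^sup>2 * G\<^sup>2 * (R / \<epsilon>)\<^sup>2 \<le> real t"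
    and w: "w \<in> RSG_outputs f G \<epsilon>0 w0 K t \<alpha>"
  shows "f w - min_value f \<le> \<epsilon>0 / \<alpha> ^ K + \<epsilon>"
proof -
  define m where "m = min_value f"
  obtain y where y: "w = y K" "y 0 = w0"
    and st: "\<And>k. k \<in> {1..K} \<Longrightarrow> RSG_stage f (\<epsilon>0 / (\<alpha> ^ k * G\<^sup>2)) t (y (k - 1)) (y k)"
    using w unfolding RSG_outputs_def by blast
  have "f (y k) - m \<le> \<epsilon>0 / \<alpha> ^ k + \<epsilon>" if "k \<le> K" for k
    using that
  proof (induction k)
    case 0
    then show ?case using y \<epsilon>0 \<epsilon> by (simp add: m_def)
  next
    case (Suc k)
    define e where "e = \<epsilon>0 / \<alpha> ^ Suc k"
    have e: "0 < e" "\<alpha> * e = \<epsilon>0 / \<alpha> ^ k" using \<alpha> \<epsilon>0 by (auto simp: e_def)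
    have IH: "f (y k) - m \<le> \<alpha> * e + \<epsilon>" using Suc e by simp
    have stage: "RSG_stage f (e / G\<^sup>2) t (y k) (y (Suc k))"
      using st[of "Suc k"] Suc.prems by (simp add: e_def)
    obtain z where z: "f z \<le> m + \<epsilon>" "\<epsilon> * dist (y k) z \<le> R * (\<alpha> * e)"
    proof (cases "f (y k) \<le> m + \<epsilon>")
      case True
      then show ?thesis using that[of "y k"] R \<alpha> e(1) by simp
    next
      case False
      then obtain z where z: "f z \<le> m + \<epsilon>" "\<epsilon> * dist (y k) z \<le> R * (f (y k) - m - \<epsilon>)"
        using sublevel_point_near[OF cf ne \<epsilon> bound, of "y k"] by (auto simp: m_def)
      have "R * (f (y k) - m - \<epsilon>) \<le> R * (\<alpha> * e)" using IH R by (simp add: mult_left_mono)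
      then show ?thesis using that z by force
    qed
    show ?case
      using RSG_stage_contracts[OF cf G e(1) \<epsilon> t stage z] by (simp add: e_def)
  qed
  from this[of K] show ?thesis by (simp add: y m_def)
qed

lemma stage_count_suffices:
  assumes "1 < \<alpha>" "0 < \<epsilon>" "\<epsilon> \<le> \<epsilon>0"
  shows "\<epsilon>0 / \<alpha> ^ nat \<lceil>log \<alpha> (\<epsilon>0 / \<epsilon>)\<rceil> \<le> \<epsilon>"
proof -
  define n where "n = nat \<lceil>log \<alpha> (\<epsilon>0 / \<epsilon>)\<rceil>"
  have "log \<alpha> (\<epsilon>0 / \<epsilon>) \<le> real n" unfolding n_def by (rule real_nat_ceiling_ge)
  then have "\<epsilon>0 / \<epsilon> \<le> \<alpha> powr real n" using assms by (simp add: log_le_iff)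
  then have "\<epsilon>0 / \<epsilon> \<le> \<alpha> ^ n" using assms by (simp add: powr_realpow)
  then show ?thesis using assms unfolding n_def[symmetric] by (simp add: field_simps)
qed

text \<open>
  The inclusion in \<open>admissible_eps\<close> supplies the slope inequality on the whole sublevel set, and the
  level set being nonempty forces \<open>\<epsilon>\<close> into the domain of \<open>\<phi>\<close>: some point has excess exactly \<open>\<epsilon>\<close> and lies
  in a slice.
\<close>

lemma admissible_error_bound:
  fixes f :: "'a::euclidean_space \<Rightarrow> real"
  assumes cf: "convex_on UNIV f" and ne: "minimizers f \<noteq> {}"
    and KL: "\<forall>wbar\<in>minimizers f. KL_property_with f wbar \<eta> (U wbar) \<phi>"
    and adm: "admissible_eps f \<eta> U \<epsilon>0 \<epsilon>"
  shows "ereal \<epsilon> < \<eta>"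
    and "f z \<le> min_value f + \<epsilon> \<Longrightarrow> infdist z (minimizers f) \<le> \<phi> \<epsilon>"
proof -
  define m where "m = min_value f"
  have \<epsilon>: "0 < \<epsilon>" using adm by (simp add: admissible_eps_def)
  have \<phi>: "desingularizing \<eta> \<phi>" using KL ne by (auto simp: KL_property_with_def)
  have cover: "\<exists>p\<in>minimizers f. x \<in> U p \<inter> KL_slice f p \<eta> \<and> ereal (f x - m) < \<eta>"
    if "f x \<le> m + \<epsilon>" "x \<notin> minimizers f" for x
  proof -
    have "x \<in> sublevel_set f \<epsilon> - minimizers f" using that by (simp add: sublevel_set_def m_def)
    then obtain p where p: "p \<in> minimizers f" "x \<in> U p \<inter> KL_slice f p \<eta>"
      using adm unfolding admissible_eps_def by blast
    then show ?thesis
      by (auto simp: KL_slice_def ereal_diff_less_iff m_def min_value_eq)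
  qed
  obtain x where x: "f x = m + \<epsilon>" using adm by (auto simp: admissible_eps_def level_set_def m_def)
  have "x \<notin> minimizers f" using min_value_eq[of x f] x \<epsilon> by (auto simp: m_def)
  with cover[of x] x show fin: "ereal \<epsilon> < \<eta>" by auto
  show "infdist z (minimizers f) \<le> \<phi> \<epsilon>" if z: "f z \<le> min_value f + \<epsilon>"
  proof -
    obtain p where p: "p \<in> minimizers f" using ne by auto
    then have mz: "0 \<le> f z - m" by (simp add: m_def min_value_eq[OF p]) (simp add: minimizers_def)
    have zle: "f z - m \<le> \<epsilon>" using z by (simp add: m_def)
    have "ereal (f z - m) < \<eta>"
      using fin zle by (meson ereal_less_eq(3) le_less_trans)
    moreover have "1 \<le> deriv \<phi> (f x - m) * norm g"
      if x: "f x \<le> f z" "x \<notin> minimizers f" "g \<in> subdifferential f x" for x g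
    proof -
      have "f x \<le> m + \<epsilon>" using x(1) zle by simp
      then obtain p where p: "p \<in> minimizers f" "x \<in> U p \<inter> KL_slice f p \<eta>" "ereal (f x - m) < \<eta>"
        using cover x(2) by blast
      have fp: "f p = m" using min_value_eq[OF p(1)] by (simp add: m_def)
      have "1 \<le> deriv \<phi> (f x - m) * subdifferential_norm f x"
        using KL p fp unfolding KL_property_with_def by auto
      moreover have "0 < f x - m" using p(2) fp by (simp add: KL_slice_def)
      then have "0 < deriv \<phi> (f x - m)" using \<phi> p(3) by (simp add: desingularizing_def)
      then have "deriv \<phi> (f x - m) * subdifferential_norm f x \<le> deriv \<phi> (f x - m) * norm g"
        using subdifferential_norm_le[OF x(3)] by simp
      ultimately show ?thesis by linarith
    qed
    ultimately have "infdist z (minimizers f) \<le> \<phi> (f z - m)"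
      using error_bound[OF cf ne \<phi>, of z] by (simp add: m_def)
    also have "\<dots> \<le> \<phi> \<epsilon>" by (rule desingularizing_mono[OF \<phi> mz zle fin])
    finally show ?thesis .
  qed
qed

text \<open>
  This makes the rounding in the number of steps harmless: it says that the number that is rounded up is
  at least \<open>\<alpha>\<^sup>2\<close>. It combines the error bound, an upper estimate for the distance of a level set point
  to the minimizers, with the lower estimate \<open>\<epsilon> / G\<close> from Lipschitz continuity.
\<close>

lemma admissible_ratio_ge:
  fixes f :: "'a::euclidean_space \<Rightarrow> real"
  assumes cf: "convex_on UNIV f" and ne: "minimizers f \<noteq> {}"
    and G: "\<forall>w. \<forall>v\<in>subdifferential f w. norm v \<le> G" "0 < G"
    and KL: "\<forall>wbar\<in>minimizers f. KL_property_with f wbar \<eta> (U wbar) \<phi>"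
    and adm: "admissible_eps f \<eta> U \<epsilon>0 \<epsilon>"
  shows "1 \<le> G * (\<phi> \<epsilon> / \<epsilon>)"
proof -
  have \<epsilon>: "0 < \<epsilon>" using adm by (simp add: admissible_eps_def)
  obtain x where x: "f x = min_value f + \<epsilon>" using adm by (auto simp: admissible_eps_def level_set_def)
  obtain p where p: "p \<in> minimizers f" "infdist x (minimizers f) = dist x p"
    using infdist_attains_inf[OF closed_minimizers[OF cf] ne] .
  have "\<epsilon> = f x - f p" using x min_value_eq[OF p(1)] by simp
  also have "\<dots> \<le> G * dist x p" by (rule bounded_subgradients_imp_lipschitz[OF cf G(1)])
  also have "\<dots> \<le> G * \<phi> \<epsilon>"
    using admissible_error_bound(2)[OF cf ne KL adm, of x] x p G by (simp add: mult_left_mono)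
  finally show ?thesis using \<epsilon> by (simp add: field_simps)
qed

lemma RSG_complexity:
  fixes f :: "'a::euclidean_space \<Rightarrow> real"
  assumes cf: "convex_on UNIV f" and ne: "minimizers f \<noteq> {}"
    and G: "\<forall>w. \<forall>v\<in>subdifferential f w. norm v \<le> G" "0 < G"
    and KL: "\<forall>wbar\<in>minimizers f. KL_property_with f wbar \<eta> (U wbar) \<phi>"
    and \<alpha>: "1 < \<alpha>" and \<epsilon>0: "0 < \<epsilon>0" "f w0 - min_value f \<le> \<epsilon>0"
    and adm: "admissible_eps f \<eta> U \<epsilon>0 \<epsilon>"
  defines "X \<equiv> \<alpha>\<^sup>2 * G\<^sup>2 * (\<phi> \<epsilon> / \<epsilon>)\<^sup>2" and "k \<equiv> \<lceil>log \<alpha> (\<epsilon>0 / \<epsilon>)\<rceil>"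
  shows "\<And>w. w \<in> RSG_outputs f G \<epsilon>0 w0 (nat k) (nat \<lceil>X\<rceil>) \<alpha> \<Longrightarrow> f w - min_value f \<le> 2 * \<epsilon>"
    and "real (RSG_iterations (nat k) (nat \<lceil>X\<rceil>)) \<le> 2 * (X * real_of_int k)"
proof -
  have \<epsilon>: "0 < \<epsilon>" "\<epsilon> \<le> \<epsilon>0" using adm by (auto simp: admissible_eps_def)
  have ratio: "1 \<le> G * (\<phi> \<epsilon> / \<epsilon>)" by (rule admissible_ratio_ge[OF cf ne G KL adm])
  then have "0 < \<phi> \<epsilon> / \<epsilon>" using G(2) by (metis less_le_trans zero_less_mult_pos zero_less_one)
  then have R: "0 < \<phi> \<epsilon>" using \<epsilon> by (simp add: zero_less_divide_iff)
  have "1 \<le> \<alpha> * (G * (\<phi> \<epsilon> / \<epsilon>))" using ratio \<alpha> mult_mono[of 1 \<alpha> 1 "G * (\<phi> \<epsilon> / \<epsilon>)"] by simp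
  then have "1\<^sup>2 \<le> (\<alpha> * (G * (\<phi> \<epsilon> / \<epsilon>)))\<^sup>2" by (intro power_mono) auto
  then have X: "1 \<le> X" by (simp add: X_def power_mult_distrib power_divide mult.assoc)
  have t: "0 < nat \<lceil>X\<rceil>" "X \<le> real (nat \<lceil>X\<rceil>)" using X by (auto simp: real_nat_ceiling_ge)
  show "f w - min_value f \<le> 2 * \<epsilon>" if w: "w \<in> RSG_outputs f G \<epsilon>0 w0 (nat k) (nat \<lceil>X\<rceil>) \<alpha>" for w
  proof -
    have "\<alpha>\<^sup>2 * G\<^sup>2 * (\<phi> \<epsilon> / \<epsilon>)\<^sup>2 \<le> real (nat \<lceil>X\<rceil>)"
      using t(2) by (simp only: X_def)
    then have "f w - min_value f \<le> \<epsilon>0 / \<alpha> ^ nat k + \<epsilon>"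
      using RSG_output_accuracy[OF cf ne G _ \<epsilon>0 \<epsilon>(1) less_imp_le[OF R]
          admissible_error_bound(2)[OF cf ne KL adm] t(1) _ w] \<alpha> by simp
    then show ?thesis using stage_count_suffices[OF \<alpha> \<epsilon>] by (simp add: k_def)
  qed
  have "0 \<le> log \<alpha> (\<epsilon>0 / \<epsilon>)" using \<alpha> \<epsilon> by (simp add: zero_le_log_cancel_iff)
  then have k: "0 \<le> k" by (simp add: k_def)
  have "real (nat \<lceil>X\<rceil>) \<le> 2 * X" using X by linarith
  then have "real (nat \<lceil>X\<rceil>) * real_of_int k \<le> (2 * X) * real_of_int k"
    using k by (intro mult_right_mono) auto
  then show "real (RSG_iterations (nat k) (nat \<lceil>X\<rceil>)) \<le> 2 * (X * real_of_int k)"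
    using k by (simp add: RSG_iterations_def)
qed


theorem corollary14:
  fixes f :: "real ^ 'd \<Rightarrow> real"
    and G \<alpha> \<epsilon>\<^sub>0 :: real
    and w\<^sub>0 :: "real ^ 'd"
    and \<eta> :: ereal
    and \<phi> :: "real \<Rightarrow> real"
    and U :: "real ^ 'd \<Rightarrow> (real ^ 'd) set"
  assumes "lower_semicontinuous f"
    and "convex_on UNIV f"
    and "minimizers f \<noteq> {}"
    and "G > 0"
    and "\<forall>w. \<forall>v\<in>subdifferential f w. norm v \<le> G"
    and "0 < \<eta>"
    and "\<forall>wbar\<in>minimizers f. KL_property_with f wbar \<eta> (U wbar) \<phi>"
    and "\<alpha> > 1"
    and "\<epsilon>\<^sub>0 > 0"
    and "f w\<^sub>0 - min_value f \<le> \<epsilon>\<^sub>0"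
  shows
    "(\<exists>C>0. \<forall>\<epsilon>. admissible_eps f \<eta> U \<epsilon>\<^sub>0 \<epsilon> \<longrightarrow>
        (let t = nat \<lceil>\<alpha>\<^sup>2 * G\<^sup>2 * (\<phi> \<epsilon> / \<epsilon>)\<^sup>2\<rceil>;
             K = nat \<lceil>log \<alpha> (\<epsilon>\<^sub>0 / \<epsilon>)\<rceil>
         in (\<forall>w\<in>RSG_outputs f G \<epsilon>\<^sub>0 w\<^sub>0 K t \<alpha>. f w - min_value f \<le> 2 * \<epsilon>) \<and>
            real (RSG_iterations K t)
              \<le> C * (\<alpha>\<^sup>2 * G\<^sup>2 * (\<phi> \<epsilon> / \<epsilon>)\<^sup>2 * real_of_int \<lceil>log \<alpha> (\<epsilon>\<^sub>0 / \<epsilon>)\<rceil>)))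
     \<and>
     (\<forall>c \<beta>. c > 0 \<and> 0 \<le> \<beta> \<and> \<beta> < 1 \<and>
        (\<forall>s. 0 \<le> s \<and> ereal s < \<eta> \<longrightarrow> \<phi> s = c * s powr (1 - \<beta>)) \<longrightarrow>
      (\<exists>C>0. \<forall>\<epsilon>. admissible_eps f \<eta> U \<epsilon>\<^sub>0 \<epsilon> \<longrightarrow>
        (let t = nat \<lceil>\<alpha>\<^sup>2 * G\<^sup>2 * c\<^sup>2 / \<epsilon> powr (2 * \<beta>)\<rceil>;
             K = nat \<lceil>log \<alpha> (\<epsilon>\<^sub>0 / \<epsilon>)\<rceil>
         in (\<forall>w\<in>RSG_outputs f G \<epsilon>\<^sub>0 w\<^sub>0 K t \<alpha>. f w - min_value f \<le> 2 * \<epsilon>) \<and>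
            real (RSG_iterations K t)
              \<le> C * (\<alpha>\<^sup>2 * G\<^sup>2 * c\<^sup>2 * (1 - \<beta>)\<^sup>2 / \<epsilon> powr (2 * \<beta>)
                     * real_of_int \<lceil>log \<alpha> (\<epsilon>\<^sub>0 / \<epsilon>)\<rceil>))))"
proof -
  have accuracy: "f w - min_value f \<le> 2 * \<epsilon>"
    if "admissible_eps f \<eta> U \<epsilon>\<^sub>0 \<epsilon>"
      and "w \<in> RSG_outputs f G \<epsilon>\<^sub>0 w\<^sub>0 (nat \<lceil>log \<alpha> (\<epsilon>\<^sub>0 / \<epsilon>)\<rceil>)
                 (nat \<lceil>\<alpha>\<^sup>2 * G\<^sup>2 * (\<phi> \<epsilon> / \<epsilon>)\<^sup>2\<rceil>) \<alpha>" for \<epsilon> w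
    using RSG_complexity(1)[OF assms(2,3,5,4,7-10) that] .
  have count: "real (RSG_iterations (nat \<lceil>log \<alpha> (\<epsilon>\<^sub>0 / \<epsilon>)\<rceil>) (nat \<lceil>\<alpha>\<^sup>2 * G\<^sup>2 * (\<phi> \<epsilon> / \<epsilon>)\<^sup>2\<rceil>))
      \<le> 2 * (\<alpha>\<^sup>2 * G\<^sup>2 * (\<phi> \<epsilon> / \<epsilon>)\<^sup>2 * real_of_int \<lceil>log \<alpha> (\<epsilon>\<^sub>0 / \<epsilon>)\<rceil>)"
    if "admissible_eps f \<eta> U \<epsilon>\<^sub>0 \<epsilon>" for \<epsilon>
    using RSG_complexity(2)[OF assms(2,3,5,4,7-10) that] .
  show ?thesis
  proof (rule conjI, goal_cases)
    case 1
    show ?case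
      unfolding Let_def by (rule exI[of _ 2]) (use accuracy count in auto)
  next
    case 2
    show ?case
    proof (intro allI impI, elim conjE)
      fix c \<beta> :: real
      assume c: "c > 0" and \<beta>: "0 \<le> \<beta>" "\<beta> < 1"
        and \<phi>: "\<forall>s. 0 \<le> s \<and> ereal s < \<eta> \<longrightarrow> \<phi> s = c * s powr (1 - \<beta>)"
      \<comment> \<open>Evaluating \<open>\<phi>\<close> at \<open>\<epsilon>\<close> is legitimate because admissibility puts \<open>\<epsilon>\<close> below \<open>\<eta>\<close>.\<close>
      have steps: "\<alpha>\<^sup>2 * G\<^sup>2 * c\<^sup>2 / \<epsilon> powr (2 * \<beta>) = \<alpha>\<^sup>2 * G\<^sup>2 * (\<phi> \<epsilon> / \<epsilon>)\<^sup>2"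
        if adm: "admissible_eps f \<eta> U \<epsilon>\<^sub>0 \<epsilon>" for \<epsilon>
      proof -
        have \<epsilon>: "0 < \<epsilon>" using adm by (simp add: admissible_eps_def)
        have "\<phi> \<epsilon> = c * \<epsilon> powr (1 - \<beta>)"
          using \<phi> \<epsilon> admissible_error_bound(1)[OF assms(2,3,7) adm] by simp
        then have "\<phi> \<epsilon> / \<epsilon> = c / \<epsilon> powr \<beta>"
          using \<epsilon> by (simp add: powr_diff)
        moreover have "(\<epsilon> powr \<beta>)\<^sup>2 = \<epsilon> powr (2 * \<beta>)"
          using \<epsilon> by (simp add: power2_eq_square flip: powr_add)
        ultimately show ?thesis by (simp add: power_divide)
      qed
      have const: "2 * (x * r) = 2 / (1 - \<beta>)\<^sup>2 * (a * (1 - \<beta>)\<^sup>2 / y * r)"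
        if "a / y = x" for a x y r :: real
        unfolding that[symmetric] using \<beta> by simp
      show "\<exists>C>0. \<forall>\<epsilon>. admissible_eps f \<eta> U \<epsilon>\<^sub>0 \<epsilon> \<longrightarrow>
        (let t = nat \<lceil>\<alpha>\<^sup>2 * G\<^sup>2 * c\<^sup>2 / \<epsilon> powr (2 * \<beta>)\<rceil>;
             K = nat \<lceil>log \<alpha> (\<epsilon>\<^sub>0 / \<epsilon>)\<rceil>
         in (\<forall>w\<in>RSG_outputs f G \<epsilon>\<^sub>0 w\<^sub>0 K t \<alpha>. f w - min_value f \<le> 2 * \<epsilon>) \<and>
            real (RSG_iterations K t)
              \<le> C * (\<alpha>\<^sup>2 * G\<^sup>2 * c\<^sup>2 * (1 - \<beta>)\<^sup>2 / \<epsilon> powr (2 * \<beta>)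
                     * real_of_int \<lceil>log \<alpha> (\<epsilon>\<^sub>0 / \<epsilon>)\<rceil>))"
      proof (intro exI[of _ "2 / (1 - \<beta>)\<^sup>2"] conjI allI impI)
        show "0 < 2 / (1 - \<beta>)\<^sup>2" using \<beta> by simp
        fix \<epsilon> assume adm: "admissible_eps f \<eta> U \<epsilon>\<^sub>0 \<epsilon>"
        show "let t = nat \<lceil>\<alpha>\<^sup>2 * G\<^sup>2 * c\<^sup>2 / \<epsilon> powr (2 * \<beta>)\<rceil>;
             K = nat \<lceil>log \<alpha> (\<epsilon>\<^sub>0 / \<epsilon>)\<rceil>
         in (\<forall>w\<in>RSG_outputs f G \<epsilon>\<^sub>0 w\<^sub>0 K t \<alpha>. f w - min_value f \<le> 2 * \<epsilon>) \<and>
            real (RSG_iterations K t)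
              \<le> 2 / (1 - \<beta>)\<^sup>2 * (\<alpha>\<^sup>2 * G\<^sup>2 * c\<^sup>2 * (1 - \<beta>)\<^sup>2 / \<epsilon> powr (2 * \<beta>)
                     * real_of_int \<lceil>log \<alpha> (\<epsilon>\<^sub>0 / \<epsilon>)\<rceil>)"
          unfolding Let_def steps[OF adm]
          using accuracy[OF adm] count[OF adm] unfolding const[OF steps[OF adm]] by blast
      qed
    qed
  qed
qed

end
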